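(* Let $\mathbb{S}$ be a totally ordered idempotent semifield and let $f\in\mathbb{S}[x_0,\dots,x_n]$ be a homogeneous polynomial such that there is a monomial ideal $M$ generated by a subset of the variables $x_0,\dots,x_n$ with $|\operatorname{supp}(f)\setminus M|=3$ and such that, writing $\operatorname{supp}(f)\setminus M=\{f_1,f_2,f_3\}$, the monomial $f_j$ does not divide $f_k^{\,i}f_\ell^{\,3-i}$ for any $\{j,k,\ell\}=\{1,2,3\}$ and $0\le i\le 3$. Then the Macaulay tropical ideal $[f]$ is not realizable. More precisely, if $J$ is any realizable tropically principal ideal over $f$, then $J$ and $[f]$ are different in degree $3\deg(f)$, i.e. $J_{3\deg(f)}\neq[f]_{3\deg(f)}$.
   Context: A totally ordered idempotent semifield $\mathbb{S}$ is a set with $0$ such that $\mathbb{S}\setminus\{0\}$ is a totally ordered abelian group (written multiplicatively), $0$ is the least element, and addition is maximum. A finite sum in $\mathbb{S}$ tropically vanishes if its value is unchanged by dropping any single term. For a polynomial $f$, $\operatorname{supp}(f)$ is the set of monomials with nonzero coefficient in $f$; a monomial lies in $M$ iff it is divisible by one of the variables generating $M$ (the empty set of variables is allowed). Tropical linear spaces. For a finite set $E$, a valuated matroid of rank $r$ is a nonzero $p\in\mathbb{S}^{\binom{E}{r}}$ such that for all $A\in\binom{E}{r+1}$, $B\in\binom{E}{r-1}$ the sum $\sum_{i\in A\setminus B}p_{A\setminus\{i\}}p_{B\cup\{i\}}$ tropically vanishes. The tropical linear space $L_p\subset\mathbb{S}^E$ of rank $r$ is the $\mathbb{S}$-submodule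 spanned by the cocircuits $\beta_C=\sum_{i\notin C}p_{C\cup\{i\}}e_i$, $C\in\binom{E}{r-1}$. Tropical ideals. Let $\Delta^n_d$ be the set of degree $d$ monomials in $x_0,\dots,x_n$; the degree $d$ part of $\mathbb{S}[x_0,\dots,x_n]$ is identified with $\mathbb{S}^{\Delta^n_d}$. A homogeneous ideal $J$ is a tropical ideal if each $J_d$ is a tropical linear space. A tropical ideal is tropically principal over $f$ if it is minimal, under inclusion, among tropical ideals containing $f$. Macaulay tropical ideal. For $d\ge\deg(f)$ the Macaulay matrix $\mathcal{D}_d(f)$ has rows indexed by $\Delta^n_{d-\deg(f)}$, columns indexed by $\Delta^n_d$, and $(X,Y)$ entry the coefficient of $Y$ in $Xf$. Then $[f]_d$ is the tropical linear space $L_p$ where $p_B$, for $B\subset\Delta^n_d$ with $|B|=|\Delta^n_{d-\deg(f)}|$, is the tropical maximal minor $\max_\sigma\prod_X\mathcal{D}_d(f)_{X,\sigma(X)}$ over bijections $\sigma:\Delta^n_{d-\deg(f)}\to B$ (the stable sum of the rows). For $d<\deg(f)$, $[f]_d=0$; and $[f]=\bigoplus_d[f]_d$. Realizability. A non-archimedean norm $\nu:\Bbbk\to\mathbb{S}$ on a field satisfies $\nu^{-1}(0)=\{0\}$, $\nu(1)=\nu(-1)=1$, $\nu(ab)=\nu(a)\nu(b)$, $\nu(a+b)\le\max(\nu(a),\nu(b))$. For $F\in\Bbbk[x_0,\dots,x_n]$, $\mathrm{trop}(F)$ is obtained by applying $\nu$ to all coefficients; for a homogeneous ideal $I$, $\mathrm{trop}(I)$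 is the graded $\mathbb{S}$-submodule with $\mathrm{trop}(I)_d$ spanned by $\{\mathrm{trop}(F):F\in I_d\}$. A tropical ideal $J\subset\mathbb{S}[x_0,\dots,x_n]$ is realizable if $J=\mathrm{trop}(I)$ for some homogeneous ideal $I\subset\Bbbk[x_0,\dots,x_n]$, where $\Bbbk$ is an algebraically closed field with a surjective non-archimedean norm $\nu:\Bbbk\to\mathbb{S}$. *)

theory Defs
  imports "HOL-Library.Poly_Mapping" "HOL-Computational_Algebra.Polynomial"
begin

class linordered_idem_semifield = comm_semiring_1 + linorder +
  assumes add_eq_max: "a + b = max a b"
    and nonzero_dvd_one: "a \<noteq> 0 \<Longrightarrow> a dvd 1"
begin

text \<open>That \<open>0\<close> is least and that multiplication is monotone need not be assumed:
  they follow from the semiring laws.\<close>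

lemma idem_semifield_zero_le: "0 \<le> a"
  using add_eq_max [of 0 a] max.cobounded1 [of 0 a] by simp

lemma idem_semifield_mult_left_mono:
  assumes "a \<le> b" shows "c * a \<le> c * b"
proof -
  have "c * b = c * (a + b)"
    using assms by (simp add: add_eq_max max_def)
  also have "\<dots> = max (c * a) (c * b)"
    by (simp only: distrib_left add_eq_max [symmetric])
  finally show ?thesis using max.cobounded1 [of "c * a" "c * b"] by (rule ssubst)
qed

end

definition tropically_vanishes :: "('i \<Rightarrow> 's::linordered_idem_semifield) \<Rightarrow> 'i set \<Rightarrow> bool" where
  "tropically_vanishes a I \<longleftrightarrow> (\<forall>j\<in>I. (\<Sum>i\<in>I - {j}. a i) = (\<Sum>i\<in>I. a i))"

text \<open>For a finite subset \<open>E\<close> of a type \<open>'e\<close>, the module of vectors \<open>S^E\<close> is represented by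
  the elements of \<open>'e \<Rightarrow>\<^sub>0 's\<close> with \<^const>\<open>Poly_Mapping.keys\<close> contained in \<open>E\<close>.\<close>

definition is_submodule :: "('e \<Rightarrow>\<^sub>0 's::comm_semiring_1) set \<Rightarrow> bool" where
  "is_submodule N \<longleftrightarrow> 0 \<in> N \<and> (\<forall>u\<in>N. \<forall>v\<in>N. u + v \<in> N)
     \<and> (\<forall>c. \<forall>v\<in>N. Poly_Mapping.map ((*) c) v \<in> N)"

text \<open>Only the values of \<open>p\<close> on the \<open>r\<close>-element subsets of \<open>E\<close> matter. Writing
  \<open>card B + 1 = r\<close> avoids truncated subtraction, so there is no such \<open>B\<close> when \<open>r = 0\<close>.\<close>

definition valuated_matroid ::
    "'e set \<Rightarrow> nat \<Rightarrow> ('e set \<Rightarrow> 's::linordered_idem_semifield) \<Rightarrow> bool" where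
  "valuated_matroid E r p \<longleftrightarrow>
     (\<exists>B. B \<subseteq> E \<and> card B = r \<and> p B \<noteq> 0) \<and>
     (\<forall>A B. A \<subseteq> E \<and> card A = r + 1 \<and> B \<subseteq> E \<and> card B + 1 = r \<longrightarrow>
        tropically_vanishes (\<lambda>i. p (A - {i}) * p (insert i B)) (A - B))"

definition cocircuit ::
    "'e set \<Rightarrow> ('e set \<Rightarrow> 's::linordered_idem_semifield) \<Rightarrow> 'e set \<Rightarrow> 'e \<Rightarrow>\<^sub>0 's" where
  "cocircuit E p C = (\<Sum>i\<in>E - C. Poly_Mapping.single i (p (insert i C)))"

definition linear_space ::
    "'e set \<Rightarrow> nat \<Rightarrow> ('e set \<Rightarrow> 's::linordered_idem_semifield) \<Rightarrow> ('e \<Rightarrow>\<^sub>0 's) set" where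
  "linear_space E r p = is_submodule hull {cocircuit E p C | C. C \<subseteq> E \<and> card C + 1 = r}"

definition tropical_linear_space ::
    "'e set \<Rightarrow> ('e \<Rightarrow>\<^sub>0 's::linordered_idem_semifield) set \<Rightarrow> bool" where
  "tropical_linear_space E L \<longleftrightarrow> (\<exists>r p. valuated_matroid E r p \<and> L = linear_space E r p)"

text \<open>The variables are indexed by a finite (automatically nonempty) type \<open>'v\<close>, so that
  \<open>n + 1 = CARD('v)\<close>. Monomials are exponent vectors, whose addition is multiplication of
  monomials; \<open>mono m\<close> is the monomial \<open>m\<close> as a polynomial.\<close>

type_synonym 'v monomial = "'v \<Rightarrow>\<^sub>0 nat"
type_synonym ('v, 'a) mpoly = "('v \<Rightarrow>\<^sub>0 nat) \<Rightarrow>\<^sub>0 'a"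

definition mdeg :: "'v::finite monomial \<Rightarrow> nat" where
  "mdeg m = (\<Sum>i\<in>UNIV. Poly_Mapping.lookup m i)"

definition mons :: "nat \<Rightarrow> 'v::finite monomial set" where
  "mons d = {m. mdeg m = d}"

lemma finite_mons: "finite (mons d :: 'v::finite monomial set)"
proof -
  have le: "Poly_Mapping.lookup m i \<le> d" if "m \<in> mons d" for m :: "'v monomial" and i
  proof -
    have "Poly_Mapping.lookup m i \<le> mdeg m"
      unfolding mdeg_def by (rule member_le_sum) simp_all
    with that show ?thesis by (simp add: mons_def)
  qed
  have "finite {g :: 'v \<Rightarrow> nat. \<forall>i. (i \<in> UNIV \<longrightarrow> g i \<in> {..d}) \<and> (i \<notin> UNIV \<longrightarrow> g i = 0)}"
    by (rule finite_set_of_finite_funs) simp_all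
  hence "finite (Poly_Mapping.lookup ` (mons d :: 'v monomial set))"
    by (rule rev_finite_subset) (simp add: image_subset_iff le)
  thus ?thesis
    by (rule finite_imageD) (rule inj_onI, rule poly_mapping_eqI, simp)
qed

definition mono :: "'v monomial \<Rightarrow> ('v, 'a::comm_semiring_1) mpoly" where
  "mono m = Poly_Mapping.single m 1"

definition var :: "'v \<Rightarrow> ('v, 'a::comm_semiring_1) mpoly" where
  "var i = mono (Poly_Mapping.single i 1)"

definition supp :: "('v, 'a::comm_semiring_1) mpoly \<Rightarrow> ('v, 'a) mpoly set" where
  "supp f = mono ` Poly_Mapping.keys f"

definition homogeneous :: "nat \<Rightarrow> ('v::finite, 'a::comm_semiring_1) mpoly \<Rightarrow> bool" where
  "homogeneous d f \<longleftrightarrow> Poly_Mapping.keys f \<subseteq> mons d"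

definition total_deg :: "('v::finite, 'a::comm_semiring_1) mpoly \<Rightarrow> nat" where
  "total_deg f = Max (insert 0 (mdeg ` Poly_Mapping.keys f))"

definition hom_part :: "nat \<Rightarrow> ('v::finite, 'a::comm_semiring_1) mpoly \<Rightarrow> ('v, 'a) mpoly" where
  "hom_part d g = (\<Sum>m\<in>mons d. Poly_Mapping.single m (Poly_Mapping.lookup g m))"

definition is_ideal :: "('v, 'a::comm_semiring_1) mpoly set \<Rightarrow> bool" where
  "is_ideal J \<longleftrightarrow> 0 \<in> J \<and> (\<forall>g\<in>J. \<forall>h\<in>J. g + h \<in> J) \<and> (\<forall>g\<in>J. \<forall>h. h * g \<in> J)"

definition homogeneous_ideal :: "('v::finite, 'a::comm_semiring_1) mpoly set \<Rightarrow> bool" where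
  "homogeneous_ideal J \<longleftrightarrow> is_ideal J \<and> (\<forall>g\<in>J. \<forall>d. hom_part d g \<in> J)"

definition deg_part ::
    "nat \<Rightarrow> ('v::finite, 'a::comm_semiring_1) mpoly set \<Rightarrow> ('v, 'a) mpoly set" where
  "deg_part d J = {g \<in> J. homogeneous d g}"

definition graded_sum ::
    "(nat \<Rightarrow> ('v::finite, 'a::comm_semiring_1) mpoly set) \<Rightarrow> ('v, 'a) mpoly set" where
  "graded_sum N = {g. \<forall>d. hom_part d g \<in> N d}"

definition tropical_ideal ::
    "('v::finite, 's::linordered_idem_semifield) mpoly set \<Rightarrow> bool" where
  "tropical_ideal J \<longleftrightarrow>
     homogeneous_ideal J \<and> (\<forall>d. tropical_linear_space (mons d) (deg_part d J))"

definition tropically_principal ::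
    "('v::finite, 's::linordered_idem_semifield) mpoly \<Rightarrow> ('v, 's) mpoly set \<Rightarrow> bool" where
  "tropically_principal f J \<longleftrightarrow> tropical_ideal J \<and> f \<in> J \<and>
     (\<forall>J'. tropical_ideal J' \<and> f \<in> J' \<and> J' \<subseteq> J \<longrightarrow> J' = J)"

definition macaulay_entry ::
    "('v, 's::linordered_idem_semifield) mpoly \<Rightarrow> 'v monomial \<Rightarrow> 'v monomial \<Rightarrow> 's" where
  "macaulay_entry f X Y = Poly_Mapping.lookup (mono X * f) Y"

text \<open>The rows are the monomials of degree \<open>k = d - total_deg f\<close>. Infinitely many total functions
  \<open>\<sigma>\<close> restrict to the same bijection, but the set of values below is finite, and it is
  nonempty when \<open>card B = card (mons k)\<close>.\<close>

definition macaulay_minor ::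
    "('v::finite, 's::linordered_idem_semifield) mpoly \<Rightarrow> nat \<Rightarrow> 'v monomial set \<Rightarrow> 's" where
  "macaulay_minor f k B =
     Max {\<Prod>X\<in>mons k. macaulay_entry f X (\<sigma> X) | \<sigma>. bij_betw \<sigma> (mons k) B}"

definition macaulay_part ::
    "('v::finite, 's::linordered_idem_semifield) mpoly \<Rightarrow> nat \<Rightarrow> ('v, 's) mpoly set" where
  "macaulay_part f d =
     (if d < total_deg f then {0}
      else linear_space (mons d) (card (mons (d - total_deg f) :: 'v monomial set))
             (macaulay_minor f (d - total_deg f)))"

definition macaulay_ideal ::
    "('v::finite, 's::linordered_idem_semifield) mpoly \<Rightarrow> ('v, 's) mpoly set" where
  "macaulay_ideal f = graded_sum (macaulay_part f)"

definition nonarch_norm :: "('k::field \<Rightarrow> 's::linordered_idem_semifield) \<Rightarrow> bool" where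
  "nonarch_norm \<nu> \<longleftrightarrow> (\<forall>a. \<nu> a = 0 \<longleftrightarrow> a = 0) \<and> \<nu> 1 = 1 \<and> \<nu> (- 1) = 1 \<and>
     (\<forall>a b. \<nu> (a * b) = \<nu> a * \<nu> b) \<and> (\<forall>a b. \<nu> (a + b) \<le> max (\<nu> a) (\<nu> b))"

definition trop_ideal ::
    "('k::field \<Rightarrow> 's::linordered_idem_semifield) \<Rightarrow> ('v::finite, 'k) mpoly set \<Rightarrow> ('v, 's) mpoly set" where
  "trop_ideal \<nu> I =
     graded_sum (\<lambda>d. is_submodule hull (Poly_Mapping.map \<nu> ` deg_part d I))"

text \<open>One cannot quantify over types inside a formula. The field is therefore passed as a type
  argument; \<open>J\<close> is realizable iff it is realizable over some type \<open>'k\<close>.\<close>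

definition realizable_over ::
    "'k::alg_closed_field itself \<Rightarrow> ('v::finite, 's::linordered_idem_semifield) mpoly set \<Rightarrow> bool" where
  "realizable_over TYPE('k) J \<longleftrightarrow>
     (\<exists>(\<nu> :: 'k \<Rightarrow> 's) I. nonarch_norm \<nu> \<and> surj \<nu> \<and> homogeneous_ideal I \<and> J = trop_ideal \<nu> I)"

end

theory Submission
  imports Defs "HOL-Library.FuncSet"
begin

text \<open>
  Write \<open>a\<close>, \<open>b\<close>, \<open>c\<close> for the three monomials of \<open>f\<close> that avoid the variables in \<open>V\<close>, and
  \<open>\<delta>\<close> for the degree of \<open>f\<close>. Suppose that \<open>f\<close> lies in \<open>J = trop(I)\<close>. Since supports never shrink
  in a span over an idempotent semifield, and since an algebraically closed field is infinite, a
  generic combination of elements of \<open>I\<close> is a polynomial \<open>F \<in> I\<close> with exactly the support of \<open>f\<close>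
  (\<open>trop_span_support_lift\<close>).

  Over a field there is a cancellation that is invisible tropically: with \<open>\<alpha>\<close>, \<open>\<beta>\<close>, \<open>\<gamma>\<close> the three
  terms of \<open>F\<close> off \<open>V\<close>,
  \<open>(\<alpha>\<^sup>2 + \<beta>\<^sup>2 + \<gamma>\<^sup>2 - \<alpha>\<beta> - \<beta>\<gamma> - \<gamma>\<alpha>)(\<alpha> + \<beta> + \<gamma>) = \<alpha>\<^sup>3 + \<beta>\<^sup>3 + \<gamma>\<^sup>3 - 3\<alpha>\<beta>\<gamma>\<close>.
  So \<open>I\<close> contains a form of degree \<open>3\<delta>\<close> whose support, off the ideal \<open>M\<close> generated by \<open>V\<close>, is
  nonempty and contained in \<open>{a\<^sup>3, b\<^sup>3, c\<^sup>3, abc}\<close> (\<open>exists_sparse_cubic_multiple\<close>).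

  The Macaulay linear space has no vector with such a support. Its Pluecker coordinate at \<open>B\<close> is
  nonzero iff the rows can be matched to \<open>B\<close> along nonzero entries, so its supports are governed by
  the transversal matroid of the Macaulay matrix. Suppose that the rows off \<open>M\<close> are matched
  injectively to columns off \<open>M\<close>; augmenting paths then show that every vector with a nonzero
  coordinate off \<open>M\<close> is nonzero on some matched column (\<open>macaulay_support_meets_matching\<close>). The
  non-divisibility hypothesis provides such a matching that avoids \<open>a\<^sup>3, b\<^sup>3, c\<^sup>3, abc\<close>: multiply a
  row by \<open>b\<close> if it is \<open>a\<^sup>2\<close> or \<open>ab\<close>, by \<open>c\<close> if it is \<open>b\<^sup>2\<close> or \<open>bc\<close>, and by \<open>a\<close> otherwise
  (\<open>inj_cubic_matching\<close>, \<open>cubic_matching_avoids\<close>).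

  Hence \<open>J\<close> and the Macaulay ideal differ in degree \<open>3\<delta>\<close>. As the Macaulay ideal contains \<open>f\<close>
  (\<open>homogeneous_in_macaulay_part\<close>), it may be taken for \<open>J\<close>; so if it were realizable, it would
  differ from itself.
\<close>

section \<open>Idempotent semifields and their modules\<close>

lemma idem_mult_eq_0_iff:
  fixes a b :: "'s::linordered_idem_semifield"
  shows "a * b = 0 \<longleftrightarrow> a = 0 \<or> b = 0"
proof
  assume ab: "a * b = 0"
  show "a = 0 \<or> b = 0"
  proof (rule disjCI)
    assume "b \<noteq> 0"
    then obtain c where "1 = b * c"
      using nonzero_dvd_one by (auto simp: dvd_def)
    then have "a = a * b * c"
      by (simp add: mult.assoc flip: \<open>1 = b * c\<close>)
    with ab show "a = 0" by simp
  qed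
qed auto

lemma idem_add_eq_0_iff:
  fixes a b :: "'s::linordered_idem_semifield"
  shows "a + b = 0 \<longleftrightarrow> a = 0 \<and> b = 0"
proof
  assume "a + b = 0"
  then have "a \<le> 0" "b \<le> 0"
    using max.cobounded1 [of a b] max.cobounded2 [of b a] by (simp_all add: add_eq_max)
  then show "a = 0 \<and> b = 0"
    by (intro conjI antisym idem_semifield_zero_le)
qed simp

lemma idem_prod_eq_0_iff:
  fixes g :: "'i \<Rightarrow> 's::linordered_idem_semifield"
  assumes "finite I"
  shows "prod g I = 0 \<longleftrightarrow> (\<exists>i\<in>I. g i = 0)"
  using assms by (induction I) (auto simp: idem_mult_eq_0_iff)

lemma lookup_map_zero:
  assumes "h 0 = 0"
  shows "Poly_Mapping.lookup (Poly_Mapping.map h p) x = h (Poly_Mapping.lookup p x)"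
  using assms by (simp add: map.rep_eq when_def)

lemma keys_map_zero_iff:
  assumes "\<And>a. h a = 0 \<longleftrightarrow> a = 0"
  shows "Poly_Mapping.keys (Poly_Mapping.map h p) = Poly_Mapping.keys p"
proof -
  have h0: "h 0 = 0" using assms by simp
  show ?thesis
    unfolding set_eq_iff in_keys_iff lookup_map_zero [of h, OF h0] assms by (intro allI refl)
qed

lemma keys_idem_add:
  fixes u v :: "'e \<Rightarrow>\<^sub>0 's::linordered_idem_semifield"
  shows "Poly_Mapping.keys (u + v) = Poly_Mapping.keys u \<union> Poly_Mapping.keys v"
  by (auto simp: in_keys_iff lookup_add idem_add_eq_0_iff)

lemma keys_idem_scale:
  fixes v :: "'e \<Rightarrow>\<^sub>0 's::linordered_idem_semifield"
  shows "Poly_Mapping.keys (Poly_Mapping.map ((*) c) v)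
           = (if c = 0 then {} else Poly_Mapping.keys v)"
proof (rule set_eqI)
  fix x
  have "Poly_Mapping.lookup (Poly_Mapping.map ((*) c) v) x = c * Poly_Mapping.lookup v x"
    by (rule lookup_map_zero) simp
  then show "x \<in> Poly_Mapping.keys (Poly_Mapping.map ((*) c) v)
      \<longleftrightarrow> x \<in> (if c = 0 then {} else Poly_Mapping.keys v)"
    unfolding in_keys_iff by (simp add: idem_mult_eq_0_iff in_keys_iff)
qed

text \<open>Over an idempotent semifield nothing cancels, so the supports occurring in a span are
  the unions of supports of generators.\<close>

lemma keys_in_span_induct:
  fixes v :: "'e \<Rightarrow>\<^sub>0 's::linordered_idem_semifield"
  assumes "v \<in> is_submodule hull N"
    and gen: "\<And>g. g \<in> N \<Longrightarrow> P (Poly_Mapping.keys g)"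
    and empty: "P {}"
    and union: "\<And>A B. finite A \<Longrightarrow> finite B \<Longrightarrow> P A \<Longrightarrow> P B \<Longrightarrow> P (A \<union> B)"
  shows "P (Poly_Mapping.keys v)"
  using assms(1)
proof (rule hull_induct)
  show "is_submodule {v :: 'e \<Rightarrow>\<^sub>0 's. P (Poly_Mapping.keys v)}"
    using empty union by (auto simp: is_submodule_def keys_idem_add keys_idem_scale)
qed (rule gen)

lemma zero_in_span: "0 \<in> is_submodule hull N"
  unfolding hull_def is_submodule_def by blast

section \<open>Monomials\<close>

lemma mdeg_add [simp]: "mdeg (a + b) = mdeg a + mdeg b"
  by (simp add: mdeg_def lookup_add sum.distrib)

lemma double_monomial_cancel: "a + a = b + b \<Longrightarrow> a = b" for a b :: "'v monomial"
proof (rule poly_mapping_eqI)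
  fix i assume "a + a = b + b"
  then have "Poly_Mapping.lookup (a + a) i = Poly_Mapping.lookup (b + b) i" by simp
  then show "Poly_Mapping.lookup a i = Poly_Mapping.lookup b i" by (simp add: lookup_add)
qed

lemma lookup_hom_part:
  "Poly_Mapping.lookup (hom_part d g) m = (if mdeg m = d then Poly_Mapping.lookup g m else 0)"
proof -
  have "Poly_Mapping.lookup (hom_part d g) m
      = (\<Sum>n\<in>mons d. if n = m then Poly_Mapping.lookup g m else 0)"
    unfolding hom_part_def lookup_sum by (intro sum.cong) (auto simp: lookup_single)
  also have "\<dots> = (if m \<in> mons d then Poly_Mapping.lookup g m else 0)"
    by (rule sum.delta) (rule finite_mons)
  finally show ?thesis by (simp add: mons_def)
qed

lemma hom_part_homogeneous:
  assumes "homogeneous e g"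
  shows "hom_part d g = (if d = e then g else 0)"
proof (rule poly_mapping_eqI)
  fix m
  show "Poly_Mapping.lookup (hom_part d g) m = Poly_Mapping.lookup (if d = e then g else 0) m"
    using assms by (cases "m \<in> Poly_Mapping.keys g")
      (auto simp: lookup_hom_part homogeneous_def mons_def in_keys_iff)
qed

lemma homogeneous_in_graded_sum_iff:
  assumes "homogeneous d g" and "\<And>e. 0 \<in> N e"
  shows "g \<in> graded_sum N \<longleftrightarrow> g \<in> N d"
  unfolding graded_sum_def mem_Collect_eq hom_part_homogeneous [OF assms(1)]
  using assms(2) by metis

lemma zero_in_macaulay_part: "0 \<in> macaulay_part f d"
  by (simp add: macaulay_part_def linear_space_def zero_in_span)

text \<open>Cancellation of exponent vectors leaves a single contributing term of the product.\<close>

lemma lookup_mono_mult: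
  "Poly_Mapping.lookup (mono x * p) (x + m) = Poly_Mapping.lookup p m"
proof -
  have 1: "Poly_Mapping.lookup (mono x * p) k
      = (\<Sum>q. Poly_Mapping.lookup p q when k = x + q)" for k
    by (simp add: mono_def lookup_mult lookup_single when_mult)
  show ?thesis
    by (simp add: 1)
qed

lemma mono_mult_mono: "mono x * mono y = mono (x + y)"
  by (simp add: mono_def mult_single)

lemma mono_inject: "mono x = (mono y :: ('v, 's::comm_semiring_1) mpoly) \<longleftrightarrow> x = y"
  by (metis mono_def keys_single one_neq_zero singleton_inject)

text \<open>As the next two lemmas show, these are the exponent vectors of the monomials of the ideal
  generated by the variables in \<open>V\<close>, and this ideal is prime as far as monomials are
  concerned.\<close>

definition monomials_divisible_by :: "'v set \<Rightarrow> 'v monomial set" where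
  "monomials_divisible_by V = {m. \<exists>i\<in>V. Poly_Mapping.lookup m i \<noteq> 0}"

lemma add_in_monomials_divisible_by:
  "a + b \<in> monomials_divisible_by V
     \<longleftrightarrow> a \<in> monomials_divisible_by V \<or> b \<in> monomials_divisible_by V"
  by (auto simp: monomials_divisible_by_def lookup_add)

text \<open>The polynomials all of whose monomials are divisible by a variable in \<open>V\<close> form an ideal that
  contains these variables, so that the generated ideal has no further monomials.\<close>

lemma mono_in_variable_ideal_iff:
  "(mono m :: ('v, 's::comm_semiring_1) mpoly) \<in> is_ideal hull (var ` V)
     \<longleftrightarrow> m \<in> monomials_divisible_by V"
proof
  let ?D = "{g :: ('v, 's) mpoly. Poly_Mapping.keys g \<subseteq> monomials_divisible_by V}"
  have "is_ideal ?D"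
    unfolding is_ideal_def
  proof (intro conjI ballI allI)
    fix g h :: "('v, 's) mpoly"
    assume g: "g \<in> ?D"
    show "h * g \<in> ?D"
      using g keys_mult [of h g] by (fastforce simp: add_in_monomials_divisible_by)
    assume "h \<in> ?D" with g show "g + h \<in> ?D"
      using keys_add [of g h] by auto
  qed simp
  then have "is_ideal hull (var ` V) \<subseteq> ?D"
    by (rule hull_minimal [rotated])
      (auto simp: var_def mono_def monomials_divisible_by_def lookup_single when_def)
  moreover assume "(mono m :: ('v, 's) mpoly) \<in> is_ideal hull (var ` V)"
  ultimately show "m \<in> monomials_divisible_by V"
    by (auto simp: mono_def)
next
  assume "m \<in> monomials_divisible_by V"
  then obtain i where i: "i \<in> V" "Poly_Mapping.lookup m i \<noteq> 0"
    by (auto simp: monomials_divisible_by_def)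
  have "m = (m - Poly_Mapping.single i 1) + Poly_Mapping.single i 1"
    using i(2) by (intro poly_mapping_eqI) (auto simp: lookup_add lookup_minus lookup_single when_def)
  then have "(mono m :: ('v, 's) mpoly) = mono (m - Poly_Mapping.single i 1) * var i"
    by (metis mono_mult_mono var_def)
  moreover have "h * g \<in> is_ideal hull (var ` V)" if "g \<in> var ` V" for g h :: "('v, 's) mpoly"
    using that by (auto simp: hull_def is_ideal_def)
  ultimately show "(mono m :: ('v, 's) mpoly) \<in> is_ideal hull (var ` V)"
    using i(1) by auto
qed

section \<open>Supports in a Macaulay linear space\<close>

lemma macaulay_entry_row_plus [simp]:
  "macaulay_entry f X (X + m) = Poly_Mapping.lookup f m"
  by (simp add: macaulay_entry_def lookup_mono_mult)

lemma macaulay_entry_nonzeroE: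
  assumes "macaulay_entry f X Y \<noteq> 0"
  obtains m where "m \<in> Poly_Mapping.keys f" "Y = X + m"
proof -
  have "Y \<in> Poly_Mapping.keys (mono X * f)"
    using assms by (simp add: macaulay_entry_def in_keys_iff)
  with keys_mult [of "mono X" f] show thesis
    using that by (auto simp: mono_def split: if_splits)
qed

text \<open>A tropical minor is a maximum of products in a structure without zero divisors, so its
  vanishing depends only on which entries of the matrix vanish.\<close>

lemma macaulay_minor_nonzero_iff:
  fixes f :: "('v::finite, 's::linordered_idem_semifield) mpoly"
  assumes "finite B" and "card B = card (mons k :: 'v monomial set)"
  shows "macaulay_minor f k B \<noteq> 0 \<longleftrightarrow>
    (\<exists>\<sigma>. bij_betw \<sigma> (mons k) B \<and> (\<forall>X\<in>mons k. macaulay_entry f X (\<sigma> X) \<noteq> 0))"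
proof -
  let ?w = "\<lambda>\<sigma>. \<Prod>X\<in>mons k. macaulay_entry f X (\<sigma> X)"
  let ?W = "{?w \<sigma> | \<sigma>. bij_betw \<sigma> (mons k) B}"
  have "?W \<subseteq> ?w ` (mons k \<rightarrow>\<^sub>E B)"
  proof
    fix w assume "w \<in> ?W"
    then obtain \<sigma> where s: "w = ?w \<sigma>" "bij_betw \<sigma> (mons k) B" by auto
    have "w = ?w (restrict \<sigma> (mons k))"
      unfolding s(1) by (rule prod.cong) auto
    moreover have "restrict \<sigma> (mons k) \<in> mons k \<rightarrow>\<^sub>E B"
      using s(2) by (auto dest: bij_betwE)
    ultimately show "w \<in> ?w ` (mons k \<rightarrow>\<^sub>E B)" by blast
  qed
  then have fin: "finite ?W"
    by (rule finite_subset) (simp add: finite_PiE finite_mons assms(1))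
  have "?W \<noteq> {}"
    using finite_same_card_bij [OF finite_mons assms(1) assms(2) [symmetric]] by auto
  then have "macaulay_minor f k B = 0 \<longleftrightarrow> (\<forall>w\<in>?W. w = 0)"
    using fin unfolding macaulay_minor_def
    by (metis (no_types, lifting) Max_in Max_ge antisym idem_semifield_zero_le)
  then show ?thesis
    by (auto simp: idem_prod_eq_0_iff finite_mons)
qed

text \<open>A basis exchange for transversal matroids, by augmenting paths: the free row \<open>X0\<close> takes its
  \<open>\<tau>\<close>-partner, which may displace another row of \<open>R0\<close>, which then takes its own partner, and so
  on. Each displacement makes \<open>\<sigma>\<close> agree with \<open>\<tau>\<close> in one more place, so that the path ends in a
  column outside \<open>C\<close>. No row outside \<open>R0\<close> is ever displaced, because the columns in \<open>\<tau> ` R0\<close> are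
  not adjacent to such rows.\<close>

lemma augment_matching:
  assumes "finite R" and "R0 \<subseteq> R" and "inj_on \<tau> R0"
    and edge: "\<And>X. X \<in> R0 \<Longrightarrow> e X (\<tau> X)"
    and sep: "\<And>X Z. X \<in> R - R0 \<Longrightarrow> Z \<in> R0 \<Longrightarrow> \<not> e X (\<tau> Z)"
    and "X0 \<in> R0" and "inj_on \<sigma> (R - {X0})" and "\<sigma> ` (R - {X0}) = C"
    and "\<And>X. X \<in> R - {X0} \<Longrightarrow> e X (\<sigma> X)"
  shows "\<exists>i\<in>\<tau> ` R0 - C. \<exists>\<rho>. bij_betw \<rho> R (insert i C) \<and> (\<forall>X\<in>R. e X (\<rho> X))"
  using assms(6-)
proof (induction "card {X \<in> R - {X0}. \<sigma> X \<noteq> \<tau> X}" arbitrary: X0 \<sigma> rule: less_induct)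
  case less
  have X0: "X0 \<in> R" using less.prems assms(2) by auto
  show ?case
  proof (cases "\<tau> X0 \<in> C")
    case False
    let ?\<rho> = "\<sigma>(X0 := \<tau> X0)"
    have im: "?\<rho> ` R = insert (\<tau> X0) C"
    proof -
      have "?\<rho> ` R = insert (?\<rho> X0) (?\<rho> ` (R - {X0}))"
        using X0 by blast
      also have "?\<rho> ` (R - {X0}) = \<sigma> ` (R - {X0})"
        by (rule image_cong) auto
      finally show ?thesis using less.prems(3) by simp
    qed
    have "inj_on ?\<rho> R"
    proof (rule inj_onI)
      fix X Y assume XY: "X \<in> R" "Y \<in> R" "?\<rho> X = ?\<rho> Y"
      have "\<sigma> Z \<noteq> \<tau> X0" if "Z \<in> R" "Z \<noteq> X0" for Z
        using that False less.prems(3) imageI [of Z "R - {X0}" \<sigma>] by auto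
      with XY show "X = Y"
        using inj_onD [OF less.prems(2), of X Y] by (metis Diff_iff fun_upd_apply singletonD)
    qed
    with im have "bij_betw ?\<rho> R (insert (\<tau> X0) C)"
      by (simp add: bij_betw_def)
    moreover have "\<forall>X\<in>R. e X (?\<rho> X)"
      using less.prems edge by auto
    ultimately show ?thesis
      using False less.prems(1) by blast
  next
    case True
    then obtain X1 where X1: "X1 \<in> R" "X1 \<noteq> X0" "\<sigma> X1 = \<tau> X0"
      using less.prems(3) by force
    \<comment> \<open>The row \<open>X1\<close> that held the column \<open>\<tau> X0\<close> becomes the new free row.\<close>
    have "X1 \<in> R0"
      using sep [of X1 X0] less.prems(1) less.prems(4) [of X1] X1 by auto
    have ne: "\<sigma> X1 \<noteq> \<tau> X1"
      using X1 \<open>X1 \<in> R0\<close> less.prems(1) assms(3) by (auto simp: inj_on_def)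
    let ?\<rho> = "\<sigma>(X0 := \<tau> X0)"
    have "{X \<in> R - {X1}. ?\<rho> X \<noteq> \<tau> X} \<subset> {X \<in> R - {X0}. \<sigma> X \<noteq> \<tau> X}"
    proof
      show "{X \<in> R - {X1}. ?\<rho> X \<noteq> \<tau> X} \<subseteq> {X \<in> R - {X0}. \<sigma> X \<noteq> \<tau> X}"
        by (auto split: if_splits)
      have "X1 \<in> {X \<in> R - {X0}. \<sigma> X \<noteq> \<tau> X}" using ne X1(1,2) by simp
      then show "{X \<in> R - {X1}. ?\<rho> X \<noteq> \<tau> X} \<noteq> {X \<in> R - {X0}. \<sigma> X \<noteq> \<tau> X}" by blast
    qed
    then have "card {X \<in> R - {X1}. ?\<rho> X \<noteq> \<tau> X} < card {X \<in> R - {X0}. \<sigma> X \<noteq> \<tau> X}"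
      using assms(1) by (intro psubset_card_mono) auto
    then show ?thesis
    proof (rule less.hyps)
      show "X1 \<in> R0" by fact
      have notin: "\<sigma> X \<noteq> \<tau> X0" if "X \<in> R" "X \<noteq> X0" "X \<noteq> X1" for X
        using inj_onD [OF less.prems(2), of X X1] that X1 by auto
      show "inj_on ?\<rho> (R - {X1})"
      proof (rule inj_onI)
        fix X Y assume "X \<in> R - {X1}" "Y \<in> R - {X1}" "?\<rho> X = ?\<rho> Y"
        then show "X = Y"
          using notin [of X] notin [of Y] inj_onD [OF less.prems(2), of X Y]
          by (auto split: if_splits)
      qed
      have "R - {X1} = insert X0 (R - {X0, X1})"
        using X0 X1(2) by blast
      then have "?\<rho> ` (R - {X1}) = insert (?\<rho> X0) (?\<rho> ` (R - {X0, X1}))"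
        by (simp only: image_insert)
      also have "\<dots> = insert (\<sigma> X1) (\<sigma> ` (R - {X0, X1}))"
        using X1(3) by (intro arg_cong2 [of _ _ _ _ insert] image_cong) auto
      also have "\<dots> = \<sigma> ` insert X1 (R - {X0, X1})"
        by (simp only: image_insert)
      also have "insert X1 (R - {X0, X1}) = R - {X0}"
        using X1(1,2) by blast
      finally show "?\<rho> ` (R - {X1}) = C"
        using less.prems(3) by simp
      show "e X (?\<rho> X)" if "X \<in> R - {X1}" for X
        using that less.prems edge by auto
    qed
  qed
qed

lemma lookup_cocircuit:
  assumes "finite E"
  shows "Poly_Mapping.lookup (cocircuit E p C) j = (if j \<in> E - C then p (insert j C) else 0)"
  using assms by (simp add: cocircuit_def lookup_sum lookup_single when_def)

text \<open>The property of a support claimed here passes to unions, so only cocircuits matter. If the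
  cocircuit of \<open>C\<close> is nonzero at \<open>j\<close>, the rows are matched to \<open>insert j C\<close>. The row matched to \<open>j\<close>
  is not divisible by a variable in \<open>V\<close>, because \<open>j\<close> is not, and freeing it gives the situation of
  \<open>augment_matching\<close>. The rows divisible by a variable in \<open>V\<close> have nonzero entries only in columns
  that are divisible too, so that they need no partner under \<open>\<tau>\<close>.\<close>

lemma macaulay_support_meets_matching:
  fixes f :: "('v::finite, 's::linordered_idem_semifield) mpoly"
  defines "D \<equiv> total_deg f"
  assumes v: "v \<in> macaulay_part f (k + D)"
    and j: "j \<in> Poly_Mapping.keys v" "j \<notin> monomials_divisible_by V"
    and inj: "inj_on \<tau> (mons k - monomials_divisible_by V)"
    and edge: "\<And>X. X \<in> mons k - monomials_divisible_by V \<Longrightarrow> macaulay_entry f X (\<tau> X) \<noteq> 0"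
    and off: "\<And>X. X \<in> mons k - monomials_divisible_by V \<Longrightarrow> \<tau> X \<notin> monomials_divisible_by V"
    and deg: "\<And>X. X \<in> mons k - monomials_divisible_by V \<Longrightarrow> \<tau> X \<in> mons (k + D)"
  shows "Poly_Mapping.keys v \<inter> \<tau> ` (mons k - monomials_divisible_by V) \<noteq> {}"
proof -
  let ?E = "mons (k + D) :: 'v monomial set"
  let ?r = "card (mons k :: 'v monomial set)"
  let ?R0 = "mons k - monomials_divisible_by V"
  let ?P = "\<lambda>A. A - monomials_divisible_by V \<noteq> {} \<longrightarrow> A \<inter> \<tau> ` ?R0 \<noteq> {}"
  have row: "Y \<in> monomials_divisible_by V"
    if "macaulay_entry f X Y \<noteq> 0" "X \<in> monomials_divisible_by V" for X Y
    using that by (auto elim!: macaulay_entry_nonzeroE simp: add_in_monomials_divisible_by)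
  have "v \<in> is_submodule hull {cocircuit ?E (macaulay_minor f k) C | C. C \<subseteq> ?E \<and> card C + 1 = ?r}"
    using v by (simp add: macaulay_part_def linear_space_def D_def)
  then have "?P (Poly_Mapping.keys v)"
  proof (rule keys_in_span_induct)
    fix g assume "g \<in> {cocircuit ?E (macaulay_minor f k) C | C. C \<subseteq> ?E \<and> card C + 1 = ?r}"
    then obtain C where g: "g = cocircuit ?E (macaulay_minor f k) C"
      and C: "C \<subseteq> ?E" "card C + 1 = ?r" by auto
    have finC: "finite C" using C(1) finite_mons by (rule finite_subset)
    have minor: "macaulay_minor f k (insert i C) \<noteq> 0 \<longleftrightarrow>
      (\<exists>\<sigma>. bij_betw \<sigma> (mons k) (insert i C) \<and> (\<forall>X\<in>mons k. macaulay_entry f X (\<sigma> X) \<noteq> 0))"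
      if "i \<notin> C" for i
      using that C finC by (intro macaulay_minor_nonzero_iff) auto
    show "?P (Poly_Mapping.keys g)"
    proof
      assume "Poly_Mapping.keys g - monomials_divisible_by V \<noteq> {}"
      then obtain j where jg: "j \<in> Poly_Mapping.keys g" "j \<notin> monomials_divisible_by V"
        by blast
      then have j: "j \<in> ?E - C" "macaulay_minor f k (insert j C) \<noteq> 0"
          "j \<notin> monomials_divisible_by V"
        by (auto simp: g in_keys_iff lookup_cocircuit finite_mons split: if_splits)
      then obtain \<sigma> where \<sigma>: "bij_betw \<sigma> (mons k) (insert j C)"
          "\<And>X. X \<in> mons k \<Longrightarrow> macaulay_entry f X (\<sigma> X) \<noteq> 0"
        using minor [of j] by auto
      obtain X0 where X0: "X0 \<in> mons k" "\<sigma> X0 = j"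
        using \<sigma>(1) by (metis bij_betw_imp_surj_on imageE insertI1)
      have "X0 \<in> ?R0"
        using row [of X0 j] \<sigma>(2) [of X0] X0 j(3) by auto
      have "\<sigma> ` (mons k - {X0}) = \<sigma> ` mons k - \<sigma> ` {X0}"
        using \<sigma>(1) X0(1)
        by (intro inj_on_image_set_diff [of _ "mons k"]) (auto simp: bij_betw_def)
      then have im: "\<sigma> ` (mons k - {X0}) = C"
        using j(1) \<sigma>(1) X0(2) by (auto simp: bij_betw_def)
      have "\<exists>i\<in>\<tau> ` ?R0 - C. \<exists>\<rho>. bij_betw \<rho> (mons k) (insert i C)
            \<and> (\<forall>X\<in>mons k. macaulay_entry f X (\<rho> X) \<noteq> 0)"
      proof (rule augment_matching [OF finite_mons _ inj])
        show "X0 \<in> ?R0" by fact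
        show "inj_on \<sigma> (mons k - {X0})"
          using \<sigma>(1) by (auto simp: bij_betw_def intro: inj_on_subset)
        show "\<sigma> ` (mons k - {X0}) = C" by (rule im)
        show "\<not> macaulay_entry f X (\<tau> Z) \<noteq> 0" if "X \<in> mons k - ?R0" "Z \<in> ?R0" for X Z
          using that row [of X "\<tau> Z"] off [of Z] by auto
      qed (use edge \<sigma>(2) in auto)
      then obtain i where i: "i \<in> \<tau> ` ?R0" "i \<notin> C" "macaulay_minor f k (insert i C) \<noteq> 0"
        using minor by blast
      then have "i \<in> Poly_Mapping.keys g"
        using deg by (auto simp: g in_keys_iff lookup_cocircuit finite_mons)
      with i(1) show "Poly_Mapping.keys g \<inter> \<tau> ` ?R0 \<noteq> {}" by blast
    qed
  qed auto
  with j show ?thesis by blast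
qed

text \<open>In degree \<open>total_deg f\<close> the Macaulay matrix has the single row \<open>f\<close>, which is then the
  only cocircuit.\<close>

lemma homogeneous_in_macaulay_part:
  fixes f :: "('v::finite, 's::linordered_idem_semifield) mpoly"
  assumes "homogeneous (total_deg f) f"
  shows "f \<in> macaulay_part f (total_deg f)"
proof -
  let ?E = "mons (total_deg f) :: 'v monomial set"
  have m0: "mons 0 = {0 :: 'v monomial}"
    by (auto simp: mons_def mdeg_def intro: poly_mapping_eqI)
  have "macaulay_minor f 0 {j} = Poly_Mapping.lookup f j" for j
  proof -
    have "{\<Prod>X\<in>mons 0. macaulay_entry f X (\<sigma> X) | \<sigma>. bij_betw \<sigma> (mons 0) {j}}
        = {macaulay_entry f 0 j}"
      by (auto simp: m0 bij_betw_def intro!: exI [of _ "\<lambda>_. j"])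
    then show ?thesis
      using macaulay_entry_row_plus [of f 0 j] by (simp add: macaulay_minor_def)
  qed
  then have "f = cocircuit ?E (macaulay_minor f 0) {}"
    using assms by (intro poly_mapping_eqI)
      (auto simp: lookup_cocircuit finite_mons homogeneous_def in_keys_iff)
  then show ?thesis
    by (auto simp: macaulay_part_def linear_space_def m0 intro!: hull_inc exI [of _ "{}"])
qed

section \<open>Supports in a realizable ideal\<close>

text \<open>Over a finite field, \<open>1 + \<Prod>a. (X - a)\<close> takes only the value \<open>1\<close>.\<close>

lemma infinite_UNIV_alg_closed_field: "infinite (UNIV :: 'k::alg_closed_field set)"
proof
  assume fin: "finite (UNIV :: 'k set)"
  define p where "p = (\<Prod>a\<in>(UNIV :: 'k set). [:- a, 1:])"
  have deg: "degree p = card (UNIV :: 'k set)"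
    unfolding p_def by (subst degree_prod_eq_sum_degree) auto
  have pos: "0 < card (UNIV :: 'k set)"
    using fin by (simp add: card_gt_0_iff)
  have "degree (p + 1) = degree p"
    using deg pos by (intro degree_add_eq_left) simp
  then obtain x where "poly (p + 1) x = 0"
    using deg pos alg_closed_imp_poly_has_root by (metis)
  moreover have "poly p x = 0"
    using fin by (auto simp: p_def poly_prod)
  ultimately show False by simp
qed

text \<open>A generic combination \<open>F + t G\<close>: each monomial excludes at most one value of \<open>t\<close>.\<close>

lemma exists_generic_combination:
  fixes F G :: "'e \<Rightarrow>\<^sub>0 'k::field"
  assumes "infinite (UNIV :: 'k set)"
  shows "\<exists>t. Poly_Mapping.keys (F + Poly_Mapping.map ((*) t) G)
               = Poly_Mapping.keys F \<union> Poly_Mapping.keys G"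
proof -
  let ?bad = "insert 0 ((\<lambda>m. - Poly_Mapping.lookup F m / Poly_Mapping.lookup G m)
                ` Poly_Mapping.keys G)"
  have "finite ?bad" by simp
  with assms obtain t where t: "t \<notin> ?bad"
    by (metis ex_new_if_finite)
  have "Poly_Mapping.lookup F m + t * Poly_Mapping.lookup G m \<noteq> 0"
    if "m \<in> Poly_Mapping.keys G" for m
  proof
    assume "Poly_Mapping.lookup F m + t * Poly_Mapping.lookup G m = 0"
    moreover have "Poly_Mapping.lookup G m \<noteq> 0" using that by (simp add: in_keys_iff)
    ultimately have "t = - Poly_Mapping.lookup F m / Poly_Mapping.lookup G m"
      by (simp add: field_simps eq_neg_iff_add_eq_0)
    with that t show False by blast
  qed
  then have "m \<in> Poly_Mapping.keys (F + Poly_Mapping.map ((*) t) G)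
      \<longleftrightarrow> m \<in> Poly_Mapping.keys F \<union> Poly_Mapping.keys G" for m
    by (cases "m \<in> Poly_Mapping.keys G") (auto simp: in_keys_iff lookup_add lookup_map_zero)
  then show ?thesis by blast
qed

text \<open>The supports of elements of \<open>I\<close> are closed under unions by the previous lemma, and the supports
  in the span are unions of supports of generators.\<close>

lemma trop_span_support_lift:
  fixes I :: "('v::finite, 'k::alg_closed_field) mpoly set"
  assumes \<nu>: "nonarch_norm \<nu>" and I: "is_ideal I"
    and "g \<in> is_submodule hull (Poly_Mapping.map \<nu> ` deg_part d I)"
  shows "\<exists>F\<in>I. Poly_Mapping.keys F = Poly_Mapping.keys g"
  using assms(3)
proof (rule keys_in_span_induct)
  fix h assume "h \<in> Poly_Mapping.map \<nu> ` deg_part d I"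
  then show "\<exists>F\<in>I. Poly_Mapping.keys F = Poly_Mapping.keys h"
    using \<nu> by (auto simp: deg_part_def keys_map_zero_iff nonarch_norm_def)
next
  show "\<exists>F\<in>I. Poly_Mapping.keys F = {}"
    using I by (intro bexI [of _ 0]) (auto simp: is_ideal_def)
next
  fix A B
  assume "\<exists>F\<in>I. Poly_Mapping.keys F = A" "\<exists>F\<in>I. Poly_Mapping.keys F = B"
  then obtain F G where FG: "F \<in> I" "G \<in> I" "Poly_Mapping.keys F = A" "Poly_Mapping.keys G = B"
    by auto
  obtain t where "Poly_Mapping.keys (F + Poly_Mapping.map ((*) t) G) = A \<union> B"
    using exists_generic_combination [OF infinite_UNIV_alg_closed_field] FG by metis
  moreover have "F + Poly_Mapping.map ((*) t) G \<in> I"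
    using I FG by (simp add: is_ideal_def mult_map_scale_conv_mult)
  ultimately show "\<exists>F\<in>I. Poly_Mapping.keys F = A \<union> B" by blast
qed

section \<open>The cubic multiple and the matching\<close>

text \<open>The monomial \<open>a\<close> divides none of \<open>b\<^sup>3\<close>, \<open>b\<^sup>2c\<close>, \<open>bc\<^sup>2\<close>, \<open>c\<^sup>3\<close>, written additively in exponent
  vectors.\<close>

definition divides_no_cubic :: "'v monomial \<Rightarrow> 'v monomial \<Rightarrow> 'v monomial \<Rightarrow> bool" where
  "divides_no_cubic a b c \<longleftrightarrow> (\<forall>n. a + n \<notin> {b + b + b, b + b + c, b + c + c, c + c + c})"

lemma divides_no_cubic_if_not_dvd:
  assumes "\<forall>i\<le>3. \<not> (mono a :: ('v, 's::comm_semiring_1) mpoly) dvd mono b ^ i * mono c ^ (3 - i)"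
  shows "divides_no_cubic a b c"
  unfolding divides_no_cubic_def
proof (intro allI notI)
  fix n assume n: "a + n \<in> {b + b + b, b + b + c, b + c + c, c + c + c}"
  have "(mono a :: ('v, 's) mpoly) dvd mono (a + n)"
    by (simp flip: mono_mult_mono)
  moreover obtain i where "i \<le> 3" "(mono (a + n) :: ('v, 's) mpoly) = mono b ^ i * mono c ^ (3 - i)"
  proof -
    consider "a + n = b + b + b" | "a + n = b + b + c" | "a + n = b + c + c" | "a + n = c + c + c"
      using n by blast
    then show thesis
    proof cases
      case 1
      then show thesis using that [of 3] by (simp add: power3_eq_cube mono_mult_mono)
    next
      case 2
      then show thesis using that [of 2] by (simp add: power2_eq_square mono_mult_mono)
    next
      case 3
      then show thesis using that [of 1] by (simp add: power2_eq_square mono_mult_mono add.assoc)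
    next
      case 4
      then show thesis using that [of 0] by (simp add: power3_eq_cube mono_mult_mono)
    qed
  qed
  ultimately show False
    using assms by simp
qed

lemma divides_no_cubicD:
  assumes "divides_no_cubic a b c" and "w = a + n"
  shows "w \<notin> {b + b + b, b + b + c, b + c + c, c + c + c}"
  using assms unfolding divides_no_cubic_def by simp

lemma divides_no_cubic_distinct:
  assumes "divides_no_cubic a b c"
  shows "a \<noteq> b" "a \<noteq> c"
proof -
  show "a \<noteq> b"
    using divides_no_cubicD [OF assms add.assoc [of a a a]] by blast
  show "a \<noteq> c"
    using divides_no_cubicD [OF assms add.assoc [of a a a]] by blast
qed

text \<open>The default is multiplication by \<open>a\<close>. It would send \<open>a\<^sup>2\<close> to \<open>a\<^sup>3\<close> and \<open>bc\<close> to \<open>abc\<close>, so these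
  rows are diverted to \<open>a\<^sup>2b\<close> and \<open>bc\<^sup>2\<close>. The default image of \<open>ab\<close> would collide with \<open>a\<^sup>2b\<close>, so
  \<open>ab\<close> goes to \<open>ab\<^sup>2\<close>; that is the default image of \<open>b\<^sup>2\<close>, which goes to \<open>b\<^sup>2c\<close>.\<close>

definition cubic_matching :: "'v monomial \<Rightarrow> 'v monomial \<Rightarrow> 'v monomial \<Rightarrow> 'v monomial \<Rightarrow> 'v monomial"
  where "cubic_matching a b c X =
    X + (if X \<in> {a + a, a + b} then b else if X \<in> {b + b, b + c} then c else a)"

text \<open>Two rows multiplied by the same monomial cannot collide. The exceptional images \<open>b\<^sup>2c\<close>,
  \<open>bc\<^sup>2\<close> are not divisible by \<open>a\<close> and all others are; the exceptional images \<open>a\<^sup>2b\<close>, \<open>ab\<^sup>2\<close> could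
  only collide with default images of the rows \<open>ab\<close>, \<open>b\<^sup>2\<close>, which are exceptional.\<close>

lemma inj_cubic_matching:
  assumes a: "divides_no_cubic a b c"
  shows "inj (cubic_matching a b c)"
proof (rule injI)
  have ab_bc: "X + b \<noteq> Y + c" if "X \<in> {a + a, a + b}" "Y \<in> {b + b, b + c}" for X Y
  proof -
    from that(1) obtain u where "X = a + u" by blast
    then have "X + b = a + (u + b)" by (simp add: add.assoc)
    with a have "X + b \<notin> {b + b + b, b + b + c, b + c + c, c + c + c}"
      by (rule divides_no_cubicD)
    moreover have "Y + c \<in> {b + b + c, b + c + c}" using that(2) by auto
    ultimately show ?thesis by auto
  qed
  have ab_a: "Y \<in> {a + b, b + b}" if "X \<in> {a + a, a + b}" "X + b = Y + a" for X Y
  proof -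
    from that(1) obtain u where u: "X = u + a" "u \<in> {a, b}"
      using add.commute [of a b] by blast
    then have "(u + b) + a = Y + a" using that(2) by (simp add: ac_simps)
    then have "u + b = Y" by (rule add_right_imp_eq)
    with u(2) show ?thesis by auto
  qed
  have bc_a: "X + c \<noteq> Y + a" if "X \<in> {b + b, b + c}" for X Y
  proof -
    have "X + c \<in> {b + b + c, b + c + c}" using that by auto
    then show ?thesis using divides_no_cubicD [OF a add.commute [of Y a]] by auto
  qed
  define S T where "S = {a + a, a + b}" and "T = {b + b, b + c}"
  have cm: "cubic_matching a b c X = X + (if X \<in> S then b else if X \<in> T then c else a)" for X
    by (simp only: cubic_matching_def S_def T_def)
  have S: "Y \<in> S" if "X \<in> S" and eq: "cubic_matching a b c X = cubic_matching a b c Y" for X Y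
  proof (rule ccontr)
    assume "Y \<notin> S"
    show False
    proof (cases "Y \<in> T")
      case True
      then have "X + b = Y + c" using eq \<open>X \<in> S\<close> \<open>Y \<notin> S\<close> by (simp add: cm)
      with ab_bc \<open>X \<in> S\<close> True show False unfolding S_def T_def by simp
    next
      case False
      then have "X + b = Y + a" using eq \<open>X \<in> S\<close> \<open>Y \<notin> S\<close> by (simp add: cm)
      from ab_a [OF \<open>X \<in> S\<close> [unfolded S_def] this] show False
        using \<open>Y \<notin> S\<close> False unfolding S_def T_def by simp
    qed
  qed
  have T: "Y \<in> T" if "X \<in> T" "X \<notin> S" "Y \<notin> S"
    and eq: "cubic_matching a b c X = cubic_matching a b c Y" for X Y
  proof (rule ccontr)
    assume "Y \<notin> T"
    then have "X + c = Y + a" using that by (simp add: cm)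
    with bc_a \<open>X \<in> T\<close> show False unfolding T_def by simp
  qed
  fix X Y assume eq: "cubic_matching a b c X = cubic_matching a b c Y"
  have "X \<in> S \<longleftrightarrow> Y \<in> S" using S eq by metis
  moreover from this have "X \<in> S \<or> (X \<in> T \<longleftrightarrow> Y \<in> T)" using T eq by metis
  ultimately show "X = Y" using eq by (auto simp: cm split: if_splits)
qed

text \<open>Each image other than \<open>xa\<close> is a product of two of the three monomials, one of them squared.
  It differs from \<open>abc\<close> by cancellation and from each cube because it has a factor that does not
  divide that cube. An image \<open>xa\<close> cannot be \<open>b\<^sup>3\<close> or \<open>c\<^sup>3\<close>, and it is \<open>a\<^sup>3\<close> or \<open>abc\<close> only for the
  exceptional rows \<open>a\<^sup>2\<close>, \<open>bc\<close>.\<close>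

lemma cubic_matching_avoids:
  assumes a: "divides_no_cubic a b c" and b: "divides_no_cubic b a c" and c: "divides_no_cubic c a b"
  shows "cubic_matching a b c X \<notin> {a + a + a, b + b + b, c + c + c, a + b + c}"
proof -
  note ne = divides_no_cubic_distinct [OF a] divides_no_cubic_distinct [OF b]
  let ?w = "cubic_matching a b c X"
  consider "X = a + a" | "X = a + b" | "X = b + b" | "X = b + c"
    | "X \<notin> {a + a, a + b, b + b, b + c}" by blast
  then show ?thesis
  proof cases
    case 1
    then have w: "?w = a + a + b" by (simp add: cubic_matching_def)
    have "?w = a + (a + b)" "?w = b + (a + a)" "?w = (a + b) + a"
      unfolding w by (simp_all add: ac_simps)
    moreover from this(3) have "?w \<noteq> a + b + c" using ne by simp
    ultimately show ?thesis
      using divides_no_cubicD [OF a] divides_no_cubicD [OF b] by blast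
  next
    case 2
    then have w: "?w = a + b + b" by (simp add: cubic_matching_def)
    have "?w = a + (b + b)" "?w = b + (a + b)"
      unfolding w by (simp_all add: ac_simps)
    moreover have "?w \<noteq> a + b + c" using w ne by simp
    ultimately show ?thesis
      using divides_no_cubicD [OF a] divides_no_cubicD [OF b] by blast
  next
    case 3
    then have w: "?w = b + b + c"
      using ne double_monomial_cancel [of a b] by (auto simp: cubic_matching_def)
    have "?w = b + (b + c)" "?w = c + (b + b)"
      unfolding w by (simp_all add: ac_simps)
    moreover have "?w \<noteq> a + b + c" using w ne by simp
    ultimately show ?thesis
      using divides_no_cubicD [OF b] divides_no_cubicD [OF c] by blast
  next
    case 4
    \<comment> \<open>The row \<open>bc\<close> does not fall under the first exception, that of \<open>a\<^sup>2\<close> and \<open>ab\<close>.\<close>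
    have "b + c \<noteq> b + a" using ne by simp
    moreover have "b + c \<noteq> a + a"
    proof
      assume "b + c = a + a"
      then have "b + b + c = a + (a + b)" by (simp add: ac_simps)
      with divides_no_cubicD [OF a this] show False by blast
    qed
    ultimately have w: "?w = b + c + c"
      using 4 by (simp add: cubic_matching_def add.commute [of a b])
    have "?w = b + (c + c)" "?w = c + (b + c)" "a + b + c = (b + c) + a"
      unfolding w by (simp_all add: ac_simps)
    moreover from this(3) have "?w \<noteq> a + b + c" using w ne by simp
    ultimately show ?thesis
      using divides_no_cubicD [OF b] divides_no_cubicD [OF c] by blast
  next
    case 5
    then have w: "?w = X + a" by (simp add: cubic_matching_def)
    have "?w = a + X" "a + b + c = (b + c) + a"
      unfolding w by (simp_all add: ac_simps)
    moreover from this(2) have "?w \<noteq> a + b + c" "?w \<noteq> a + a + a" using w 5 by auto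
    ultimately show ?thesis
      using divides_no_cubicD [OF a] by blast
  qed
qed

lemma homogeneous_mult: "homogeneous d g \<Longrightarrow> homogeneous e h \<Longrightarrow> homogeneous (d + e) (g * h)"
  using keys_mult [of g h] unfolding homogeneous_def mons_def by fastforce

lemma homogeneous_add: "homogeneous d g \<Longrightarrow> homogeneous d h \<Longrightarrow> homogeneous d (g + h)"
  using keys_add [of g h] unfolding homogeneous_def by blast

lemma homogeneous_diff:
  fixes g h :: "('v::finite, 'k::comm_ring_1) mpoly"
  shows "homogeneous d g \<Longrightarrow> homogeneous d h \<Longrightarrow> homogeneous d (g - h)"
proof -
  have "Poly_Mapping.keys (g - h) \<subseteq> Poly_Mapping.keys g \<union> Poly_Mapping.keys h"
    by (auto simp: in_keys_iff lookup_minus)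
  then show "homogeneous d g \<Longrightarrow> homogeneous d h \<Longrightarrow> homogeneous d (g - h)"
    unfolding homogeneous_def by blast
qed

lemma sum_of_cubes_identity:
  fixes a b c m :: "'a::comm_ring_1"
  shows "(a*a + b*b + c*c - a*b - b*c - c*a) * (a + b + c + m) =
    a*a*a + b*b*b + c*c*c - (a*b*c + a*b*c + a*b*c)
      + (a*a + b*b + c*c - a*b - b*c - c*a) * m"
  by (simp add: algebra_simps)

text \<open>The multiplier is the quadratic factor of \<open>\<alpha>\<^sup>3 + \<beta>\<^sup>3 + \<gamma>\<^sup>3 - 3\<alpha>\<beta>\<gamma>\<close> in the three terms of \<open>F\<close>
  off \<open>V\<close>; the remaining terms of \<open>F\<close> only contribute monomials divisible by a variable in \<open>V\<close>.
  The monomial \<open>a\<^sup>3\<close> survives because it differs from \<open>b\<^sup>3\<close>, \<open>c\<^sup>3\<close> and \<open>abc\<close>.\<close>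

lemma exists_sparse_cubic_multiple:
  fixes F :: "('v::finite, 'k::field) mpoly"
  assumes F: "Poly_Mapping.keys F - monomials_divisible_by V = {a, b, c}"
    and hom: "homogeneous d F"
    and a: "divides_no_cubic a b c" and bc: "b \<noteq> c"
  shows "\<exists>Q. homogeneous (2 * d) Q \<and> a + a + a \<in> Poly_Mapping.keys (Q * F) \<and>
    Poly_Mapping.keys (Q * F) - monomials_divisible_by V
      \<subseteq> {a + a + a, b + b + b, c + c + c, a + b + c}"
proof -
  note ne = divides_no_cubic_distinct [OF a] bc
  define A where "A = Poly_Mapping.single a (Poly_Mapping.lookup F a)"
  define B where "B = Poly_Mapping.single b (Poly_Mapping.lookup F b)"
  define C where "C = Poly_Mapping.single c (Poly_Mapping.lookup F c)"
  define m where "m = F - A - B - C"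
  define Q where "Q = A*A + B*B + C*C - A*B - B*C - C*A"
  have F_eq: "F = A + B + C + m" by (simp add: m_def)
  have m: "Poly_Mapping.keys m \<subseteq> monomials_divisible_by V"
  proof
    fix x assume "x \<in> Poly_Mapping.keys m"
    then have "x \<in> Poly_Mapping.keys F - {a, b, c}"
      using ne by (auto simp: m_def A_def B_def C_def in_keys_iff lookup_minus lookup_single when_def
          split: if_splits)
    with F show "x \<in> monomials_divisible_by V" by blast
  qed
  have "Poly_Mapping.lookup (Q * m) x = 0" if "x \<notin> monomials_divisible_by V" for x
    using that keys_mult [of Q m] m
    by (fastforce simp: add_in_monomials_divisible_by simp flip: not_in_keys_iff_lookup_eq_zero)
  moreover have "Q * F = A*A*A + B*B*B + C*C*C - (A*B*C + A*B*C + A*B*C) + Q * m"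
    unfolding F_eq Q_def by (rule sum_of_cubes_identity)
  ultimately have QF: "Poly_Mapping.lookup (Q * F) x =
      Poly_Mapping.lookup (A*A*A) x + Poly_Mapping.lookup (B*B*B) x + Poly_Mapping.lookup (C*C*C) x
      - (Poly_Mapping.lookup (A*B*C) x + Poly_Mapping.lookup (A*B*C) x + Poly_Mapping.lookup (A*B*C) x)"
    if "x \<notin> monomials_divisible_by V" for x
    using that by (simp only: lookup_add lookup_minus add_0_right not_False_eq_True)
  have in_F: "a \<in> Poly_Mapping.keys F" "b \<in> Poly_Mapping.keys F" "c \<in> Poly_Mapping.keys F"
      "a \<notin> monomials_divisible_by V"
    using F by blast+
  have "a + a + a \<notin> monomials_divisible_by V"
    using in_F(4) by (simp add: add_in_monomials_divisible_by)
  \<comment> \<open>Otherwise \<open>a\<^sup>2 = bc\<close>, and \<open>a\<close> would divide \<open>bc\<^sup>2 = a\<^sup>2c\<close>.\<close>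
  moreover have "a + a + a \<noteq> a + b + c"
  proof
    assume "a + a + a = a + b + c"
    then have "a + (a + a) = a + (b + c)" by (simp only: add.assoc)
    then have "a + a = b + c" by (rule add_left_imp_eq)
    then have "b + c + c = a + (a + c)" by (simp flip: add.assoc)
    with divides_no_cubicD [OF a this] show False by blast
  qed
  moreover have "a + a + a \<noteq> b + b + b" "a + a + a \<noteq> c + c + c"
    using divides_no_cubicD [OF a add.assoc [of a a a]] by blast+
  ultimately have "Poly_Mapping.lookup (Q * F) (a + a + a) = Poly_Mapping.lookup F a ^ 3"
    by (simp add: QF A_def B_def C_def mult_single lookup_single_not_eq
        power3_eq_cube)
  then have "a + a + a \<in> Poly_Mapping.keys (Q * F)"
    using in_F(1) by (simp add: in_keys_iff)
  moreover have "Poly_Mapping.keys (Q * F) - monomials_divisible_by V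
      \<subseteq> {a + a + a, b + b + b, c + c + c, a + b + c}"
  proof
    fix x assume "x \<in> Poly_Mapping.keys (Q * F) - monomials_divisible_by V"
    then show "x \<in> {a + a + a, b + b + b, c + c + c, a + b + c}"
      using QF [of x]
      by (auto simp: in_keys_iff A_def B_def C_def mult_single lookup_single when_def
          split: if_splits)
  qed
  moreover have "homogeneous (2 * d) Q"
  proof -
    have "homogeneous d A" "homogeneous d B" "homogeneous d C"
      using hom in_F by (auto simp: homogeneous_def A_def B_def C_def)
    then show ?thesis
      unfolding Q_def mult_2 by (intro homogeneous_diff homogeneous_add homogeneous_mult)
  qed
  ultimately show ?thesis by blast
qed

text \<open>The tropicalization of the sparse multiple \<open>Q F\<close> lies in \<open>J\<close>. If it were in the Macaulay ideal,
  its support would meet the matched columns, but off \<open>V\<close> it is contained in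
  \<open>{a\<^sup>3, b\<^sup>3, c\<^sup>3, abc}\<close>, which the matching avoids.\<close>

lemma realizable_differs_from_macaulay:
  fixes f :: "('v::finite, 's::linordered_idem_semifield) mpoly"
  assumes f: "homogeneous (total_deg f) f" "f \<in> J"
    and keys: "Poly_Mapping.keys f - monomials_divisible_by V = {a, b, c}"
    and a: "divides_no_cubic a b c" and b: "divides_no_cubic b a c" and c: "divides_no_cubic c a b"
    and real: "realizable_over TYPE('k::alg_closed_field) J"
  shows "deg_part (3 * total_deg f) J \<noteq> deg_part (3 * total_deg f) (macaulay_ideal f)"
proof
  let ?d = "total_deg f"
  let ?R0 = "mons (2 * ?d) - monomials_divisible_by V"
  assume eq: "deg_part (3 * ?d) J = deg_part (3 * ?d) (macaulay_ideal f)"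
  obtain \<nu> :: "'k \<Rightarrow> 's" and I where \<nu>: "nonarch_norm \<nu>" and I: "homogeneous_ideal I"
    and J: "J = trop_ideal \<nu> I"
    using real unfolding realizable_over_def by blast
  have ideal: "is_ideal I" using I by (simp add: homogeneous_ideal_def)
  have \<nu>0: "\<nu> x = 0 \<longleftrightarrow> x = 0" for x using \<nu> by (simp add: nonarch_norm_def)
  have in_J: "g \<in> J \<longleftrightarrow> g \<in> is_submodule hull (Poly_Mapping.map \<nu> ` deg_part e I)"
    if "homogeneous e g" for e g
    unfolding J trop_ideal_def using that zero_in_span by (rule homogeneous_in_graded_sum_iff)
  obtain F where F: "F \<in> I" "Poly_Mapping.keys F = Poly_Mapping.keys f"
    using trop_span_support_lift [OF \<nu> ideal] in_J [OF f(1)] f(2) by metis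
  have homF: "homogeneous ?d F"
    using f(1) F(2) by (simp add: homogeneous_def)
  obtain Q where Q: "homogeneous (2 * ?d) Q" "a + a + a \<in> Poly_Mapping.keys (Q * F)"
    "Poly_Mapping.keys (Q * F) - monomials_divisible_by V
      \<subseteq> {a + a + a, b + b + b, c + c + c, a + b + c}"
    using exists_sparse_cubic_multiple [of F V a b c ?d] keys F(2) homF a
      divides_no_cubic_distinct(2) [OF b] by auto
  define v where "v = Poly_Mapping.map \<nu> (Q * F)"
  have kv: "Poly_Mapping.keys v = Poly_Mapping.keys (Q * F)"
    by (simp add: v_def keys_map_zero_iff \<nu>0)
  have "homogeneous (2 * ?d + ?d) (Q * F)"
    using Q(1) homF by (rule homogeneous_mult)
  then have homG: "homogeneous (3 * ?d) (Q * F)" by simp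
  then have homv: "homogeneous (3 * ?d) v" by (simp add: homogeneous_def kv)
  have "Q * F \<in> deg_part (3 * ?d) I"
    using homG ideal F(1) by (simp add: deg_part_def is_ideal_def)
  then have "v \<in> is_submodule hull (Poly_Mapping.map \<nu> ` deg_part (3 * ?d) I)"
    unfolding v_def by (intro hull_inc imageI)
  then have "v \<in> J"
    by (simp only: in_J [OF homv])
  then have "v \<in> macaulay_ideal f"
    using eq homv by (auto simp: deg_part_def)
  then have "v \<in> macaulay_part f (2 * ?d + ?d)"
    using homogeneous_in_graded_sum_iff [OF homv zero_in_macaulay_part]
    by (simp add: macaulay_ideal_def)
  moreover note Q(2) [folded kv]
  moreover have in_f: "{a, b, c} \<subseteq> Poly_Mapping.keys f" "a \<notin> monomials_divisible_by V"
      "b \<notin> monomials_divisible_by V" "c \<notin> monomials_divisible_by V"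
    using keys by blast+
  then have "a + a + a \<notin> monomials_divisible_by V"
    by (simp add: add_in_monomials_divisible_by)
  moreover have "inj_on (cubic_matching a b c) ?R0"
    using inj_cubic_matching [OF a] by (rule inj_on_subset) simp
  moreover have shift: "\<exists>y\<in>{a, b, c}. cubic_matching a b c X = X + y" for X
    by (simp add: cubic_matching_def)
  have "macaulay_entry f X (cubic_matching a b c X) \<noteq> 0" for X
  proof -
    obtain y where "y \<in> Poly_Mapping.keys f" "cubic_matching a b c X = X + y"
      using shift [of X] in_f(1) by blast
    then show ?thesis by (simp add: in_keys_iff)
  qed
  moreover have "cubic_matching a b c X \<notin> monomials_divisible_by V" if "X \<in> ?R0" for X
    using shift [of X] in_f(2-) that by (auto simp: add_in_monomials_divisible_by)
  moreover have "cubic_matching a b c X \<in> mons (2 * ?d + ?d)" if "X \<in> ?R0" for X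
    using shift [of X] in_f(1) f(1) that by (auto simp: homogeneous_def mons_def)
  ultimately have "Poly_Mapping.keys v \<inter> cubic_matching a b c ` ?R0 \<noteq> {}"
    by (rule macaulay_support_meets_matching)
  then obtain X where "X \<in> ?R0" "cubic_matching a b c X \<in> Poly_Mapping.keys (Q * F)"
    using kv by auto
  moreover have "cubic_matching a b c X \<notin> monomials_divisible_by V"
    using shift [of X] in_f(2-) calculation(1) by (auto simp: add_in_monomials_divisible_by)
  ultimately show False
    using cubic_matching_avoids [OF a b c, of X] Q(3) by blast
qed

theorem theorem4p3p1:
  fixes f :: "('v::finite, 's::linordered_idem_semifield) mpoly"
    and M :: "('v, 's) mpoly set"
    and V :: "'v set"
  assumes "\<exists>d. homogeneous d f"
    and "M = is_ideal hull (var ` V)"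
    and "card (supp f - M) = 3"
    and "\<forall>fj fk fl. supp f - M = {fj, fk, fl} \<longrightarrow> (\<forall>i\<le>3. \<not> fj dvd fk ^ i * fl ^ (3 - i))"
  shows "\<not> realizable_over TYPE('k::alg_closed_field) (macaulay_ideal f) \<and>
    (\<forall>J. realizable_over TYPE('k) J \<and> tropically_principal f J \<longrightarrow>
       deg_part (3 * total_deg f) J \<noteq> deg_part (3 * total_deg f) (macaulay_ideal f))"
proof -
  let ?K = "Poly_Mapping.keys f - monomials_divisible_by V"
  have supp: "supp f - M = mono ` ?K"
    by (auto simp: supp_def assms(2) mono_in_variable_ideal_iff)
  have "card ?K = 3"
    using assms(3) unfolding supp by (simp add: card_image inj_on_def mono_inject)
  then obtain a b c where K: "?K = {a, b, c}"
    by (auto simp: card_3_iff)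
  have "divides_no_cubic x y z" if "{a, b, c} = {x, y, z}" for x y z
    using assms(4) unfolding supp K that
    by (intro divides_no_cubic_if_not_dvd [where 's = 's]) auto
  then have abc: "divides_no_cubic a b c" "divides_no_cubic b a c" "divides_no_cubic c a b"
    by blast+
  obtain d where d: "homogeneous d f" using assms(1) by blast
  have "a \<in> Poly_Mapping.keys f" using K by blast
  then have "mdeg ` Poly_Mapping.keys f = {d}"
    using d by (auto simp: homogeneous_def mons_def)
  then have "total_deg f = d" by (simp add: total_deg_def)
  with d have f: "homogeneous (total_deg f) f" by simp
  note differs = realizable_differs_from_macaulay [OF f _ K abc]
  have "f \<in> macaulay_ideal f"
    unfolding macaulay_ideal_def homogeneous_in_graded_sum_iff [OF f zero_in_macaulay_part]
    using f by (rule homogeneous_in_macaulay_part)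
  then show ?thesis
    using differs by (auto simp: tropically_principal_def)
qed

end
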